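(* Let $I'=(\mathcal{C},w,x'_{min},x'_{max},(f_i)_{i=1}^n)$ be an instance of the Single Row Problem, let $x_{min}\le x'_{min}<x'_{max}\le x_{max}$ be real numbers, let $I=(\mathcal{C},w,x_{min},x_{max},(f_i)_{i=1}^n)$, and let $(x^*_i)_{i=1}^n$ be the solution computed by the Clumping Algorithm on $I$. Then an optimum solution $(x'^*_i)_{i=1}^n$ of $I'$ is given by \[x'^*_i=\min\Big\{x'_{max}-\sum_{j=i}^n w(C_j),\ \max\Big\{x'_{min}+\sum_{j=1}^{i-1}w(C_j),\ x^*_i\Big\}\Big\}\quad (i=1,\dots,n).\]
   Context: Single Row Problem: an instance is a tuple $(\mathcal{C},w,x_{min},x_{max},(f_i)_{i=1}^n)$ with an ordered set of cells $\mathcal{C}=\{C_1,\dots,C_n\}$, widths $w:\mathcal{C}\to\mathbb{R}_{>0}$, reals $x_{min},x_{max}$ with $\sum_{i=1}^n w(C_i)\le x_{max}-x_{min}$, and convex continuous functions $f_i:\mathbb{R}\to\mathbb{R}$. The task is to find reals $(x_i)_{i=1}^n$ minimizing $\sum_i f_i(x_i)$ subject to $x_{min}\le x_1$, $x_i+w(C_i)\le x_{i+1}$ for $i=1,\dots,n-1$, and $x_n+w(C_n)\le x_{max}$. Clumping Algorithm (run on an instance with interval $[x_{min},x_{max}]$): For a cell index $i$ and its current function $f_i$, let $[f_i^-,f_i^+]$ denote the set of minimizers of the current $f_i$ over $[x_{min}+\sum_{j=1}^{i-1}w(C_j),\ x_{max}-\sum_{j=i}^n w(C_j)]$. Maintain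 an ordered list $\mathcal{L}$, initially $(C_0,C_1,\dots,C_n)$ where $C_0$ is an auxiliary element with $x_0:=x_{min}$ and $w_0:=0$; set $w_i:=w(C_i)$ for $i\ge1$. For $i=1,\dots,n$ call PLACE$(C_i)$, where PLACE$(C_i)$ is: let $C_h$ be the predecessor of $C_i$ in $\mathcal{L}$; if $x_h+w_h\le f_i^+$, set $x_i:=\max\{x_h+w_h,f_i^-\}$; otherwise call COLLAPSE$(C_h,C_i)$ and then PLACE$(C_h)$. COLLAPSE$(C_h,C_i)$ redefines $f_h$ as $x\mapsto f_h(x)+f_i(x+w_h)$ (and accordingly $f_h^-,f_h^+$ w.r.t. $[x_{min}+\sum_{j=1}^{h-1}w(C_j),x_{max}-\sum_{j=h}^n w(C_j)]$), sets $w_h:=w_h+w_i$, and removes $C_i$ from $\mathcal{L}$. Finally, for $i=1,\dots,n$ in increasing order with $C_i\notin\mathcal{L}$, set $x_i:=x_{i-1}+w(C_{i-1})$; the output is $(x_i)_{i=1}^n$. *)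

theory Defs
  imports "HOL-Analysis.Analysis"
begin

text \<open>
  The cells \<open>C\<^sub>1, \<dots>, C\<^sub>n\<close> are represented by their indices \<open>1, \<dots>, n\<close>; index \<open>0\<close> is the
  auxiliary list element \<open>C\<^sub>0\<close>. Families indexed by cells are functions on \<^typ>\<open>nat\<close>, of which
  only the values on \<open>{1..n}\<close> matter.
\<close>

definition srp_instance ::
    "nat \<Rightarrow> (nat \<Rightarrow> real) \<Rightarrow> real \<Rightarrow> real \<Rightarrow> (nat \<Rightarrow> real \<Rightarrow> real) \<Rightarrow> bool" where
  "srp_instance n w xmin xmax f \<longleftrightarrow>
     (\<forall>i\<in>{1..n}. 0 < w i) \<and>
     (\<Sum>i=1..n. w i) \<le> xmax - xmin \<and>
     (\<forall>i\<in>{1..n}. convex_on UNIV (f i) \<and> continuous_on UNIV (f i))"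

definition srp_feasible ::
    "nat \<Rightarrow> (nat \<Rightarrow> real) \<Rightarrow> real \<Rightarrow> real \<Rightarrow> (nat \<Rightarrow> real) \<Rightarrow> bool" where
  "srp_feasible n w xmin xmax x \<longleftrightarrow>
     (1 \<le> n \<longrightarrow> xmin \<le> x 1) \<and>
     (\<forall>i\<in>{1..<n}. x i + w i \<le> x (i + 1)) \<and>
     (1 \<le> n \<longrightarrow> x n + w n \<le> xmax)"

definition srp_optimal ::
    "nat \<Rightarrow> (nat \<Rightarrow> real) \<Rightarrow> real \<Rightarrow> real \<Rightarrow> (nat \<Rightarrow> real \<Rightarrow> real) \<Rightarrow> (nat \<Rightarrow> real) \<Rightarrow> bool" where
  "srp_optimal n w xmin xmax f x \<longleftrightarrow>
     is_arg_min (\<lambda>y. \<Sum>i=1..n. f i (y i)) (srp_feasible n w xmin xmax) x"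

definition cell_range :: "nat \<Rightarrow> (nat \<Rightarrow> real) \<Rightarrow> real \<Rightarrow> real \<Rightarrow> nat \<Rightarrow> real set" where
  "cell_range n w xmin xmax i = {xmin + (\<Sum>j=1..<i. w j) .. xmax - (\<Sum>j=i..n. w j)}"

definition minimizers :: "(real \<Rightarrow> real) \<Rightarrow> real set \<Rightarrow> real set" where
  "minimizers g S = {t. is_arg_min g (\<lambda>u. u \<in> S) t}"

text \<open>
  For convex continuous \<open>g\<close> and a nonempty compact interval \<open>S\<close>, the set of minimizers is a
  compact interval; the following are its endpoints (see \<open>minimizers_eq\<close> below).
\<close>

definition min_left :: "(real \<Rightarrow> real) \<Rightarrow> real set \<Rightarrow> real" where
  "min_left g S = Inf (minimizers g S)"

definition min_right :: "(real \<Rightarrow> real) \<Rightarrow> real set \<Rightarrow> real" where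
  "min_right g S = Sup (minimizers g S)"

lemma minimizers_eq:
  assumes "convex_on UNIV g" "continuous_on UNIV g" "a \<le> b"
  shows "minimizers g {a..b} = {min_left g {a..b} .. min_right g {a..b}}"
    and "minimizers g {a..b} \<noteq> {}"
proof -
  obtain m where m: "m \<in> {a..b}" "\<And>t. t \<in> {a..b} \<Longrightarrow> g m \<le> g t"
    using continuous_attains_inf[of "{a..b}" g] assms continuous_on_subset[of UNIV g "{a..b}"]
    by auto
  have eq: "minimizers g {a..b} = {a..b} \<inter> {t. g t \<le> g m}"
    using m by (force simp: minimizers_def is_arg_min_def)
  have "convex {t. g t \<le> g m}"
    unfolding convex_def
  proof (clarsimp)
    fix x y u v :: real
    assume *: "g x \<le> g m" "g y \<le> g m" "0 \<le> u" "0 \<le> v" "u + v = 1"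
    have "g (u * x + v * y) \<le> u * g x + v * g y"
      using assms(1) * unfolding convex_on_def by auto
    also have "\<dots> \<le> g m"
      using * by (intro convex_bound_le) auto
    finally show "g (u * x + v * y) \<le> g m" .
  qed
  hence cv: "convex (minimizers g {a..b})"
    unfolding eq by (intro convex_Int) auto
  have "closed {t. g t \<le> g m}"
    by (intro closed_Collect_le assms continuous_on_const)
  hence "compact (minimizers g {a..b})"
    unfolding eq by (intro compact_Int_closed) auto
  moreover show ne: "minimizers g {a..b} \<noteq> {}"
    unfolding eq using m by auto
  ultimately obtain c d where "minimizers g {a..b} = {c..d}"
    using cv connected_compact_interval_1 convex_connected by metis
  with ne show "minimizers g {a..b} = {min_left g {a..b} .. min_right g {a..b}}"
    by (auto simp: min_left_def min_right_def)
qed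

text \<open>
  State of the algorithm: the list \<open>\<L>\<close>, the positions \<open>x\<^sub>i\<close>, and the current widths \<open>w\<^sub>i\<close> and
  functions \<open>f\<^sub>i\<close>, which change when clumps are formed.
\<close>

record clump_state =
  clist :: "nat list"
  pos :: "nat \<Rightarrow> real"
  cur_w :: "nat \<Rightarrow> real"
  cur_f :: "nat \<Rightarrow> real \<Rightarrow> real"

definition init_state ::
    "nat \<Rightarrow> (nat \<Rightarrow> real) \<Rightarrow> real \<Rightarrow> (nat \<Rightarrow> real \<Rightarrow> real) \<Rightarrow> clump_state" where
  "init_state n w xmin f =
     \<lparr>clist = [0..<n + 1],
      pos = (\<lambda>i. if i = 0 then xmin else undefined),
      cur_w = w(0 := 0),
      cur_f = f\<rparr>"

definition predecessor :: "nat list \<Rightarrow> nat \<Rightarrow> nat" where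
  "predecessor L i = last (takeWhile (\<lambda>j. j \<noteq> i) L)"

definition collapse :: "nat \<Rightarrow> nat \<Rightarrow> clump_state \<Rightarrow> clump_state" where
  "collapse h i s =
     \<lparr>clist = remove1 i (clist s),
      pos = pos s,
      cur_w = (cur_w s)(h := cur_w s h + cur_w s i),
      cur_f = (cur_f s)(h := (\<lambda>x. cur_f s h x + cur_f s i (x + cur_w s h)))\<rparr>"

text \<open>
  The recursion equation holds unconditionally because the recursion is a tail call; on
  arguments for which it does not terminate the value is unspecified.
\<close>

partial_function (tailrec) place ::
    "nat \<Rightarrow> (nat \<Rightarrow> real) \<Rightarrow> real \<Rightarrow> real \<Rightarrow> nat \<Rightarrow> clump_state \<Rightarrow> clump_state" where
  "place n w xmin xmax i s =
     (let h = predecessor (clist s) i;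
          fminus = min_left (cur_f s i) (cell_range n w xmin xmax i);
          fplus = min_right (cur_f s i) (cell_range n w xmin xmax i)
      in if pos s h + cur_w s h \<le> fplus
         then s\<lparr>pos := (pos s)(i := max (pos s h + cur_w s h) fminus)\<rparr>
         else place n w xmin xmax h (collapse h i s))"

definition clumping ::
    "nat \<Rightarrow> (nat \<Rightarrow> real) \<Rightarrow> real \<Rightarrow> real \<Rightarrow> (nat \<Rightarrow> real \<Rightarrow> real) \<Rightarrow> nat \<Rightarrow> real" where
  "clumping n w xmin xmax f =
     (let s = fold (place n w xmin xmax) [1..<n + 1] (init_state n w xmin f)
      in fold (\<lambda>i x. if i \<in> set (clist s) then x else x(i := x (i - 1) + w (i - 1)))
           [1..<n + 1] (pos s))"

end

theory Submission
  imports Defs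
begin

text \<open>
  In the coordinates \<open>y\<^sub>i = x\<^sub>i - (w\<^sub>1 + \<dots> + w\<^sub>i\<^sub>-\<^sub>1)\<close> the problem is a bounded isotonic regression
  \<open>a \<le> y\<^sub>1 \<le> \<dots> \<le> y\<^sub>n \<le> b\<close>, and Clumping is the pool-adjacent-violators algorithm. Every clump it
  forms is poolable: any monotone assignment to the cells of the clump is at least as expensive
  as some constant assignment with a value between its extremes. Poolability survives a collapse,
  because there the position of the left clump exceeds all minimizers of the right one. The final
  position of a clump minimizes its total cost over \<open>{a..b}\<close>, so by convexity its projection to
  \<open>{a'..b'}\<close> minimizes that cost over \<open>{a'..b'}\<close>. By poolability the projection beats all monotone
  assignments with values in \<open>{a'..b'}\<close>, and it remains to add up over the clumps.
\<close>

section \<open>Minimizers of convex functions\<close>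

lemma convex_on_le_towards_smaller:
  fixes g :: "real \<Rightarrow> real"
  assumes "convex_on UNIV g" "g v \<le> g t" "c \<in> closed_segment v t"
  shows "g c \<le> g t"
proof -
  obtain u where u: "0 \<le> u" "u \<le> 1" "c = (1 - u) *\<^sub>R v + u *\<^sub>R t"
    using assms(3) by (auto simp: in_segment)
  have "g c \<le> (1 - u) * g v + u * g t"
    using assms(1) u unfolding convex_on_def by auto
  also have "\<dots> \<le> (1 - u) * g t + u * g t"
    using u assms(2) by (intro add_right_mono mult_left_mono) auto
  finally show ?thesis by (simp add: algebra_simps)
qed

lemma in_minimizers_iff:
  "t \<in> minimizers g S \<longleftrightarrow> t \<in> S \<and> (\<forall>u\<in>S. g t \<le> g u)"
  by (force simp: minimizers_def is_arg_min_def)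

text \<open>The form in which convexity enters both the merging of two clumps and the projection of
  a clump to the smaller interval.\<close>

lemma convex_on_le_towards_minimizer:
  fixes g :: "real \<Rightarrow> real"
  assumes "convex_on UNIV g" "v \<in> minimizers g S" "t \<in> S" "c \<in> closed_segment v t"
  shows "g c \<le> g t"
  using assms by (intro convex_on_le_towards_smaller[of g v t c]) (auto simp: in_minimizers_iff)

lemma minimizers_shift:
  fixes c :: real
  shows "x \<in> minimizers (\<lambda>x. g (x - c)) {a + c..b + c} \<longleftrightarrow> x - c \<in> minimizers g {a..b}"
proof -
  have "(\<forall>u\<in>{a + c..b + c}. g (x - c) \<le> g (u - c)) \<longleftrightarrow> (\<forall>u\<in>{a..b}. g (x - c) \<le> g u)"
  proof (intro iffI ballI)
    fix u assume *: "\<forall>u\<in>{a + c..b + c}. g (x - c) \<le> g (u - c)" "u \<in> {a..b}"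
    show "g (x - c) \<le> g u"
      using bspec[OF *(1), of "u + c"] *(2) by simp
  qed auto
  then show ?thesis by (auto simp: in_minimizers_iff)
qed

lemma convex_on_shift:
  fixes g :: "real \<Rightarrow> real"
  assumes "convex_on UNIV g"
  shows "convex_on UNIV (\<lambda>x. g (x + c))"
proof (rule convex_onI)
  fix t x y :: real assume "0 < t" "t < 1"
  then have "g ((1 - t) *\<^sub>R (x + c) + t *\<^sub>R (y + c)) \<le> (1 - t) * g (x + c) + t * g (y + c)"
    using assms by (intro convex_onD) auto
  then show "g ((1 - t) *\<^sub>R x + t *\<^sub>R y + c) \<le> (1 - t) * g (x + c) + t * g (y + c)"
    by (simp add: algebra_simps)
qed simp

section \<open>Poolable clumps\<close>

definition offset :: "(nat \<Rightarrow> real) \<Rightarrow> nat \<Rightarrow> real" where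
  "offset w i = (\<Sum>j=1..<i. w j)"

text \<open>Here \<open>y\<close> is in shifted coordinates, where a clump of abutting cells is a
  constant function. Blocks are half-open so that adjacent ones share an endpoint.\<close>

definition clump_cost ::
    "(nat \<Rightarrow> real) \<Rightarrow> (nat \<Rightarrow> real \<Rightarrow> real) \<Rightarrow> nat \<Rightarrow> nat \<Rightarrow> (nat \<Rightarrow> real) \<Rightarrow> real" where
  "clump_cost w f h e y = (\<Sum>j=h..<e. f j (y j + offset w j))"

text \<open>Bounding \<open>t\<close> by the extreme values of \<open>y\<close> has two uses: it
  orders the constants obtained for two adjacent clumps, and it keeps \<open>t\<close> in every
  interval that contains the values of \<open>y\<close>.\<close>

definition poolable ::
    "(nat \<Rightarrow> real) \<Rightarrow> (nat \<Rightarrow> real \<Rightarrow> real) \<Rightarrow> real set \<Rightarrow> nat \<Rightarrow> nat \<Rightarrow> bool" where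
  "poolable w f S h e \<longleftrightarrow>
     (\<forall>y. mono_on {h..<e} y \<longrightarrow> y ` {h..<e} \<subseteq> S \<longrightarrow>
        (\<exists>t\<in>{y h..y (e - 1)}. clump_cost w f h e (\<lambda>_. t) \<le> clump_cost w f h e y))"

lemma offset_Suc: "1 \<le> i \<Longrightarrow> offset w (Suc i) = offset w i + w i"
  by (simp add: offset_def)

lemma offset_split:
  assumes "1 \<le> h" "h \<le> e"
  shows "offset w e = offset w h + (\<Sum>j=h..<e. w j)"
  using sum.atLeastLessThan_concat[OF assms, of w] by (simp add: offset_def)

lemma clump_cost_split:
  "h \<le> i \<Longrightarrow> i \<le> e \<Longrightarrow> clump_cost w f h e y = clump_cost w f h i y + clump_cost w f i e y"
  unfolding clump_cost_def by (simp add: sum.atLeastLessThan_concat)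

lemma clump_cost_cong:
  "(\<And>j. j \<in> {h..<e} \<Longrightarrow> y j = z j) \<Longrightarrow> clump_cost w f h e y = clump_cost w f h e z"
  unfolding clump_cost_def by (rule sum.cong) auto

lemma poolable_singleton: "poolable w f S i (Suc i)"
  by (auto simp: poolable_def clump_cost_def)

text \<open>Poolability of the two halves reduces \<open>y\<close> to constants \<open>s\<close> and
  \<open>t\<close> with \<open>s <= t\<close>. The minimizers \<open>v\<close> and \<open>q\<close>
  are in the opposite order, so the halves pull towards each other and can meet at a common value in
  \<open>{s..t}\<close> without raising either cost.\<close>

lemma poolable_merge:
  fixes a b v q :: real
  assumes "h < i" "i < e"
    and P: "poolable w f {a..b} h i" "poolable w f {a..b} i e"
    and cv: "convex_on UNIV (\<lambda>t. clump_cost w f h i (\<lambda>_. t))"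
      "convex_on UNIV (\<lambda>t. clump_cost w f i e (\<lambda>_. t))"
    and v: "v \<in> minimizers (\<lambda>t. clump_cost w f h i (\<lambda>_. t)) {a..b}"
    and q: "q \<in> minimizers (\<lambda>t. clump_cost w f i e (\<lambda>_. t)) {a..b}"
    and "q < v"
  shows "poolable w f {a..b} h e"
  unfolding poolable_def
proof (intro allI impI)
  fix y assume y: "mono_on {h..<e} y" "y ` {h..<e} \<subseteq> {a..b}"
  let ?A = "\<lambda>t. clump_cost w f h i (\<lambda>_. t)" and ?B = "\<lambda>t. clump_cost w f i e (\<lambda>_. t)"
  have "mono_on {h..<i} y" "mono_on {i..<e} y"
    using \<open>h < i\<close> \<open>i < e\<close> by (auto intro!: mono_onI mono_onD[OF y(1)])
  moreover have "y ` {h..<i} \<subseteq> {a..b}" "y ` {i..<e} \<subseteq> {a..b}"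
    using \<open>h < i\<close> \<open>i < e\<close> y(2) by (auto simp: image_subset_iff)
  ultimately obtain s t where s: "s \<in> {y h..y (i - 1)}" "?A s \<le> clump_cost w f h i y"
    and t: "t \<in> {y i..y (e - 1)}" "?B t \<le> clump_cost w f i e y"
    using P unfolding poolable_def by meson
  have "y (i - 1) \<le> y i"
    using \<open>h < i\<close> \<open>i < e\<close> by (intro mono_onD[OF y(1)]) auto
  then have "s \<le> t" using s t by auto
  have "y h \<in> {a..b}" "y (e - 1) \<in> {a..b}"
    using \<open>h < i\<close> \<open>i < e\<close> y(2) by (auto simp: image_subset_iff)
  then have ab: "s \<in> {a..b}" "t \<in> {a..b}"
    using s t \<open>s \<le> t\<close> \<open>y (i - 1) \<le> y i\<close> by auto
  \<comment> \<open>The witness is the projection of \<open>v\<close> to \<open>{s..t}\<close>. The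
    left half moves from \<open>s\<close> towards \<open>v\<close>; the right half moves, if at all,
    from \<open>t\<close> down towards \<open>q\<close>, stopping above it.\<close>
  have "\<exists>u\<in>{s..t}. ?A u \<le> ?A s \<and> ?B u \<le> ?B t"
  proof (cases "t \<le> v")
    case True
    have "?A t \<le> ?A s"
      by (rule convex_on_le_towards_minimizer[OF cv(1) v ab(1)])
        (use True \<open>s \<le> t\<close> in \<open>auto simp: closed_segment_eq_real_ivl\<close>)
    then show ?thesis using \<open>s \<le> t\<close> by auto
  next
    case False
    show ?thesis
    proof (cases "v \<le> s")
      case True
      have "?B s \<le> ?B t"
        by (rule convex_on_le_towards_minimizer[OF cv(2) q ab(2)])
          (use True \<open>q < v\<close> \<open>s \<le> t\<close> in \<open>auto simp: closed_segment_eq_real_ivl\<close>)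
      then show ?thesis using \<open>s \<le> t\<close> by auto
    next
      case False
      have "?B v \<le> ?B t"
        by (rule convex_on_le_towards_minimizer[OF cv(2) q ab(2)])
          (use \<open>\<not> t \<le> v\<close> \<open>q < v\<close> in \<open>auto simp: closed_segment_eq_real_ivl\<close>)
      moreover have "?A v \<le> ?A s"
        using v ab by (auto simp: in_minimizers_iff)
      ultimately show ?thesis
        using False \<open>\<not> t \<le> v\<close> by (intro bexI[of _ v]) auto
    qed
  qed
  then obtain u where u: "u \<in> {s..t}" "?A u \<le> ?A s" "?B u \<le> ?B t" by blast
  have "clump_cost w f h e (\<lambda>_. u) \<le> clump_cost w f h e y"
    using u s t \<open>h < i\<close> \<open>i < e\<close> by (simp add: clump_cost_split[of h i e])
  moreover have "u \<in> {y h..y (e - 1)}"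
    using u s t by auto
  ultimately show "\<exists>t\<in>{y h..y (e - 1)}. clump_cost w f h e (\<lambda>_. t) \<le> clump_cost w f h e y"
    by blast
qed

section \<open>The invariant of the algorithm\<close>

locale single_row =
  fixes n :: nat and w :: "nat \<Rightarrow> real" and xmin xmax :: real and f :: "nat \<Rightarrow> real \<Rightarrow> real"
  assumes instance_ok: "srp_instance n w xmin xmax f"
begin

text \<open>In shifted coordinates all cells have the same range
  \<open>{xmin..ymax}\<close>.\<close>

definition ymax :: real where
  "ymax = xmax - (\<Sum>j=1..n. w j)"

abbreviation block_cost :: "nat \<Rightarrow> nat \<Rightarrow> real \<Rightarrow> real" where
  "block_cost h e t \<equiv> clump_cost w f h e (\<lambda>_. t)"

text \<open>Positions are left unconstrained, so that a clump just formed by a collapse and still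
  waiting to be placed is covered too.\<close>

definition is_block :: "clump_state \<Rightarrow> nat \<Rightarrow> nat \<Rightarrow> bool" where
  "is_block s h e \<longleftrightarrow> 1 \<le> h \<and> h < e \<and> e \<le> n + 1 \<and>
     cur_w s h = (\<Sum>j=h..<e. w j) \<and>
     cur_f s h = (\<lambda>x. block_cost h e (x - offset w h)) \<and>
     poolable w f {xmin..ymax} h e"

text \<open>The list acts as a stack of clump heads on top of \<open>0\<close>, and \<open>e\<close>
  is the first cell beyond the last clump. Inverting \<open>snoc\<close> pops the top clump.\<close>

inductive placed :: "clump_state \<Rightarrow> nat list \<Rightarrow> nat \<Rightarrow> bool" for s where
  start: "pos s 0 = xmin \<Longrightarrow> cur_w s 0 = 0 \<Longrightarrow> placed s [0] 1"
| snoc: "placed s ls h \<Longrightarrow> is_block s h e \<Longrightarrow>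
     pos s h - offset w h \<in> minimizers (block_cost h e) {xmin..ymax} \<Longrightarrow>
     pos s (last ls) + cur_w s (last ls) \<le> pos s h \<Longrightarrow>
     placed s (ls @ [h]) e"

section \<open>Block costs and their minimizers over the common range\<close>

lemma xmin_le_ymax: "xmin \<le> ymax"
  using instance_ok by (auto simp: srp_instance_def ymax_def)

lemma convex_block_cost:
  assumes "1 \<le> h" "e \<le> n + 1"
  shows "convex_on UNIV (block_cost h e)"
proof -
  have "convex_on UNIV (\<lambda>t. \<Sum>j\<in>J. f j (t + offset w j))" if "finite J" "J \<subseteq> {h..<e}" for J
    using that
  proof (induction J rule: finite_induct)
    case empty
    then show ?case by (simp add: convex_on_def)
  next
    case (insert j J)
    then have "convex_on UNIV (f j)"
      using instance_ok assms by (auto simp: srp_instance_def)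
    then have "convex_on UNIV (\<lambda>t. f j (t + offset w j))"
      by (rule convex_on_shift)
    with insert show ?case by (simp add: convex_on_add)
  qed
  then show ?thesis by (simp add: clump_cost_def)
qed

lemma continuous_block_cost:
  assumes "1 \<le> h" "e \<le> n + 1"
  shows "continuous_on UNIV (block_cost h e)"
  unfolding clump_cost_def
proof (intro continuous_on_sum)
  fix j assume "j \<in> {h..<e}"
  then have "continuous_on UNIV (f j)"
    using instance_ok assms by (auto simp: srp_instance_def)
  then show "continuous_on UNIV (\<lambda>t. f j (t + offset w j))"
    by (rule continuous_on_compose2) (auto intro: continuous_intros)
qed

lemma cell_range_eq:
  assumes "1 \<le> i" "i \<le> n"
  shows "cell_range n w xmin xmax i = {xmin + offset w i..ymax + offset w i}"
proof -
  have "(\<Sum>j=1..n. w j) = offset w i + (\<Sum>j=i..n. w j)"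
    using sum.atLeastLessThan_concat[of 1 i "Suc n" w] assms
    by (simp add: offset_def atLeastLessThanSuc_atLeastAtMost)
  then show ?thesis by (simp add: cell_range_def ymax_def offset_def)
qed

text \<open>Carries the bounds tested by \<open>place\<close> over to shifted coordinates: function
  and range are both translated by \<open>offset w i\<close>. The second claim is the existence of a
  minimizer.\<close>

lemma block_minimizers:
  assumes "is_block s i e"
  shows "x \<in> {min_left (cur_f s i) (cell_range n w xmin xmax i)..
              min_right (cur_f s i) (cell_range n w xmin xmax i)} \<longleftrightarrow>
         x - offset w i \<in> minimizers (block_cost i e) {xmin..ymax}"
    and "min_left (cur_f s i) (cell_range n w xmin xmax i)
          \<le> min_right (cur_f s i) (cell_range n w xmin xmax i)"
proof -
  have i: "1 \<le> i" "i < e" "e \<le> n + 1"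
    and f: "cur_f s i = (\<lambda>x. block_cost i e (x - offset w i))"
    using assms by (auto simp: is_block_def)
  have R: "cell_range n w xmin xmax i = {xmin + offset w i..ymax + offset w i}"
    using i by (intro cell_range_eq) auto
  have cv: "convex_on UNIV (cur_f s i)"
    unfolding f using convex_on_shift[OF convex_block_cost[OF i(1,3)], of "- offset w i"] by simp
  have ct: "continuous_on UNIV (cur_f s i)"
    unfolding f
    by (rule continuous_on_compose2[OF continuous_block_cost[OF i(1,3)]])
      (auto intro: continuous_intros)
  have le: "xmin + offset w i \<le> ymax + offset w i"
    using xmin_le_ymax by simp
  note eq = minimizers_eq[OF cv ct le]
  show "x \<in> {min_left (cur_f s i) (cell_range n w xmin xmax i)..
              min_right (cur_f s i) (cell_range n w xmin xmax i)} \<longleftrightarrow>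
         x - offset w i \<in> minimizers (block_cost i e) {xmin..ymax}"
    unfolding R eq(1)[symmetric] unfolding f by (rule minimizers_shift)
  show "min_left (cur_f s i) (cell_range n w xmin xmax i)
          \<le> min_right (cur_f s i) (cell_range n w xmin xmax i)"
    unfolding R using eq by auto
qed

section \<open>Preservation of the invariant under placing and collapsing\<close>

lemma placed_less: "placed s ls e \<Longrightarrow> j \<in> set ls \<Longrightarrow> j < e"
  by (induction rule: placed.induct) (force simp: is_block_def)+

lemma placed_nonempty: "placed s ls e \<Longrightarrow> ls \<noteq> []"
  by (induction rule: placed.induct) auto

text \<open>Changing the position of a new clump, or the width and function of a popped one, thus
  leaves the clumps further left intact.\<close>

lemma placed_cong:
  assumes "placed s ls e"
    and "\<And>j. j < e \<Longrightarrow> pos s' j = pos s j \<and> cur_w s' j = cur_w s j \<and> cur_f s' j = cur_f s j"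
  shows "placed s' ls e"
  using assms
proof (induction rule: placed.induct)
  case start
  then show ?case by (intro placed.start) simp_all
next
  case (snoc ls h e)
  have "h < e" using snoc.hyps(2) by (simp add: is_block_def)
  moreover have "last ls < h"
    using placed_less[OF snoc.hyps(1)] placed_nonempty[OF snoc.hyps(1)] by simp
  ultimately show ?case
    using snoc by (intro placed.snoc) (auto simp: is_block_def)
qed

text \<open>Applied with \<open>q\<close> the largest minimizer of the right clump. In shifted
  coordinates, the failed test of \<open>place\<close> says that this minimizer lies below the
  position of the left clump, as \<open>poolable_merge\<close> requires.\<close>

lemma is_block_collapse:
  assumes "is_block s h i" "is_block s i e"
    and v: "pos s h - offset w h \<in> minimizers (block_cost h i) {xmin..ymax}"
    and q: "q - offset w i \<in> minimizers (block_cost i e) {xmin..ymax}"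
    and "q < pos s h + cur_w s h"
  shows "is_block (collapse h i s) h e"
proof -
  have hi: "1 \<le> h" "h < i" "i < e" "e \<le> n + 1"
    using assms by (auto simp: is_block_def)
  have off: "offset w i = offset w h + cur_w s h"
    using assms(1) offset_split[of h i w] hi by (simp add: is_block_def)
  have "poolable w f {xmin..ymax} h e"
  proof (rule poolable_merge[OF hi(2,3) _ _ _ _ v q])
    show "q - offset w i < pos s h - offset w h"
      using assms(5) off by simp
  qed (use assms hi in \<open>auto simp: is_block_def intro!: convex_block_cost\<close>)
  moreover have "(\<Sum>j=h..<e. w j) = (\<Sum>j=h..<i. w j) + (\<Sum>j=i..<e. w j)"
    using hi by (simp add: sum.atLeastLessThan_concat)
  moreover have "block_cost h e (x - offset w h) =
      cur_f s h x + cur_f s i (x + cur_w s h)" for x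
    using assms(1,2) off hi
    by (simp add: is_block_def clump_cost_split[of h i e] algebra_simps)
  ultimately show ?thesis
    using assms(1,2) hi by (auto simp: is_block_def collapse_def)
qed

text \<open>Each collapse removes the last entry of \<open>ls\<close>, so induction on this prefix
  also takes the place of a termination argument for \<open>place\<close>. The end \<open>e\<close>
  stays fixed while the head \<open>i\<close> moves left.\<close>

lemma place_placed:
  assumes "placed s ls i" "is_block s i e" "clist s = ls @ i # [e..<n + 1]"
    and "\<forall>j\<ge>e. cur_w s j = w j \<and> cur_f s j = f j"
  shows "\<exists>ls'. placed (place n w xmin xmax i s) ls' e \<and>
           clist (place n w xmin xmax i s) = ls' @ [e..<n + 1] \<and>
           (\<forall>j\<ge>e. cur_w (place n w xmin xmax i s) j = w j \<and>
                   cur_f (place n w xmin xmax i s) j = f j)"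
  using assms
proof (induction ls arbitrary: s i rule: rev_induct)
  case Nil
  then show ?case using placed_nonempty by blast
next
  case (snoc h ls)
  note bli = snoc.prems(2) and clist = snoc.prems(3) and rest = snoc.prems(4) and IH = snoc.IH
  let ?lo = "min_left (cur_f s i) (cell_range n w xmin xmax i)"
  let ?hi = "min_right (cur_f s i) (cell_range n w xmin xmax i)"
  let ?s' = "s\<lparr>pos := (pos s)(i := max (pos s h + cur_w s h) ?lo)\<rparr>"
  have ie: "1 \<le> i" "i < e" "e \<le> n + 1"
    using snoc.prems(2) by (auto simp: is_block_def)
  have lt: "j < i" if "j \<in> set (ls @ [h])" for j
    using placed_less[OF snoc.prems(1) that] .
  have "takeWhile (\<lambda>j. j \<noteq> i) (clist s) = ls @ [h]"
    unfolding clist using lt by (subst takeWhile_append2) auto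
  then have pre: "predecessor (clist s) i = h"
    by (simp add: predecessor_def)
  note step = place.simps[of n w xmin xmax i s, unfolded pre Let_def]
  show ?case
  proof (cases "pos s h + cur_w s h \<le> ?hi")
    case True
    then have eq: "place n w xmin xmax i s = ?s'"
      using step by simp
    have "placed ?s' (ls @ [h]) i"
      using snoc.prems(1) by (rule placed_cong) auto
    moreover have "is_block ?s' i e"
      using snoc.prems(2) by (simp add: is_block_def)
    \<comment> \<open>The maximum lies between \<open>?lo\<close> and \<open>?hi\<close>, since both
      of its arguments are at most \<open>?hi\<close>.\<close>
    moreover have "pos ?s' i - offset w i \<in> minimizers (block_cost i e) {xmin..ymax}"
      unfolding block_minimizers(1)[OF snoc.prems(2), symmetric]
      using True block_minimizers(2)[OF snoc.prems(2)] by simp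
    moreover have "pos ?s' (last (ls @ [h])) + cur_w ?s' (last (ls @ [h])) \<le> pos ?s' i"
      using lt by auto
    ultimately have "placed ?s' ((ls @ [h]) @ [i]) e"
      by (rule placed.snoc)
    moreover have "clist ?s' = ((ls @ [h]) @ [i]) @ [e..<n + 1]"
      using snoc.prems(3) by simp
    ultimately show ?thesis
      unfolding eq using snoc.prems(4) by (intro exI[of _ "(ls @ [h]) @ [i]"]) auto
  next
    case False
    let ?c = "collapse h i s"
    have hi: "?hi - offset w i \<in> minimizers (block_cost i e) {xmin..ymax}"
      unfolding block_minimizers(1)[OF snoc.prems(2), symmetric]
      using block_minimizers(2)[OF snoc.prems(2)] by simp
    have eq: "place n w xmin xmax i s = place n w xmin xmax h ?c"
      using step False by simp
    from snoc.prems(1) show ?thesis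
    proof cases
      case start
      \<comment> \<open>The auxiliary cell \<open>C\<^sub>0\<close> is never collapsed: its right edge is the left end of the range.\<close>
      then have "pos s h + cur_w s h \<le> ?hi"
        using hi by (auto simp: in_minimizers_iff offset_def)
      with False show ?thesis by simp
    next
      case (snoc ls' h')
      then have pl: "placed s ls h" and bl: "is_block s h i"
        and v: "pos s h - offset w h \<in> minimizers (block_cost h i) {xmin..ymax}"
        by auto
      have "h < i" using bl by (simp add: is_block_def)
      have "placed ?c ls h"
        using pl by (rule placed_cong) (auto simp: collapse_def)
      moreover have "is_block ?c h e"
        using is_block_collapse[OF bl bli v hi] False by simp
      moreover have "clist ?c = ls @ h # [e..<n + 1]"
        using clist lt by (auto simp: collapse_def remove1_append)
      moreover have "\<forall>j\<ge>e. cur_w ?c j = w j \<and> cur_f ?c j = f j"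
        using rest \<open>h < i\<close> ie by (auto simp: collapse_def)
      ultimately show ?thesis
        unfolding eq by (rule IH)
    qed
  qed
qed

lemma fold_place_placed:
  assumes "k \<le> n"
  defines "s \<equiv> fold (place n w xmin xmax) [1..<k + 1] (init_state n w xmin f)"
  shows "\<exists>ls. placed s ls (k + 1) \<and> clist s = ls @ [k + 1..<n + 1] \<and>
           (\<forall>j\<ge>k + 1. cur_w s j = w j \<and> cur_f s j = f j)"
  using assms(1) unfolding s_def
proof (induction k)
  case 0
  have "placed (init_state n w xmin f) [0] 1"
    by (rule placed.start) (auto simp: init_state_def)
  then show ?case
    by (intro exI[of _ "[0]"]) (auto simp: init_state_def upt_conv_Cons simp del: upt_Suc)
next
  case (Suc k)
  let ?s = "fold (place n w xmin xmax) [1..<k + 1] (init_state n w xmin f)"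
  obtain ls where ls: "placed ?s ls (k + 1)" "clist ?s = ls @ [k + 1..<n + 1]"
    "\<forall>j\<ge>k + 1. cur_w ?s j = w j \<and> cur_f ?s j = f j"
    using Suc by auto
  \<comment> \<open>A cell not yet processed is a clump by itself; the claim about indices from
    \<open>k + 1\<close> on is carried through the induction for this.\<close>
  have "is_block ?s (k + 1) (Suc k + 1)"
    using ls(3) Suc.prems by (auto simp: is_block_def clump_cost_def poolable_singleton)
  moreover have "clist ?s = ls @ (k + 1) # [Suc k + 1..<n + 1]"
    using ls(2) Suc.prems by (simp add: upt_conv_Cons del: upt_Suc)
  ultimately have "\<exists>ls'. placed (place n w xmin xmax (k + 1) ?s) ls' (Suc k + 1) \<and>
      clist (place n w xmin xmax (k + 1) ?s) = ls' @ [Suc k + 1..<n + 1] \<and>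
      (\<forall>j\<ge>Suc k + 1. cur_w (place n w xmin xmax (k + 1) ?s) j = w j \<and>
                     cur_f (place n w xmin xmax (k + 1) ?s) j = f j)"
    using ls(3) by (intro place_placed[OF ls(1)]) auto
  then show ?case by simp
qed

section \<open>The computed positions\<close>

text \<open>Induction over the clumps. The second conjunct drives it: the new clump starts no
  earlier than the right edge of the previous one, so all earlier shifted positions are at most the
  new one. The cost bounds of the clumps add up.\<close>

lemma placed_positions:
  assumes "placed s ls e"
    and "\<And>j. j \<in> {1..<e} \<Longrightarrow> x j = (if j \<in> set ls then pos s j else x (j - 1) + w (j - 1))"
    and ab: "xmin \<le> a" "a \<le> b" "b \<le> ymax"
  defines "y \<equiv> \<lambda>j. x j - offset w j"
  shows "mono_on {1..<e} y \<and>
     (\<forall>j\<in>{1..<e}. y j + offset w e \<le> pos s (last ls) + cur_w s (last ls)) \<and>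
     (\<forall>z. mono_on {1..<e} z \<longrightarrow> z ` {1..<e} \<subseteq> {a..b} \<longrightarrow>
        clump_cost w f 1 e (\<lambda>j. min b (max a (y j))) \<le> clump_cost w f 1 e z)"
  using assms(1,2)
proof (induction rule: placed.induct)
  case start
  then show ?case by (auto simp: clump_cost_def mono_on_def)
next
  case (snoc ls h e)
  have h: "1 \<le> h" "h < e" "e \<le> n + 1"
    using snoc.hyps(2) by (auto simp: is_block_def)
  have lt: "j < h" if "j \<in> set ls" for j
    using placed_less[OF snoc.hyps(1) that] .
  have "x j = (if j \<in> set ls then pos s j else x (j - 1) + w (j - 1))" if "j \<in> {1..<h}" for j
    using snoc.prems[of j] that h by auto
  note IH = snoc.IH[OF this]
  define v where "v = pos s h - offset w h"
  \<comment> \<open>Only \<open>h\<close> itself is a list entry among these indices, so the others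
    abut their predecessors and share its shifted position.\<close>
  have const: "h \<le> j \<Longrightarrow> j < e \<Longrightarrow> y j = v" for j
  proof (induction j rule: dec_induct)
    case base
    then show ?case using snoc.prems[of h] h by (simp add: y_def v_def)
  next
    case (step j)
    then have "x (Suc j) = x j + w j"
      using snoc.prems[of "Suc j"] lt[of "Suc j"] h by auto
    then show ?case using step h by (simp add: y_def offset_Suc)
  qed
  have edge: "pos s h + cur_w s h = v + offset w e"
    using snoc.hyps(2) offset_split[of h e w] h by (simp add: is_block_def v_def)
  have below: "y j \<le> v" if "j \<in> {1..<h}" for j
  proof -
    have "y j + offset w h \<le> pos s (last ls) + cur_w s (last ls)"
      using IH that by blast
    then show ?thesis using snoc.hyps(4) by (simp add: v_def)
  qed
  have "mono_on {1..<e} y"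
  proof (rule mono_onI)
    fix i j assume ij: "i \<in> {1..<e}" "j \<in> {1..<e}" "i \<le> j"
    consider "j < h" | "i < h" "h \<le> j" | "h \<le> i" by linarith
    then show "y i \<le> y j"
    proof cases
      case 1
      then show ?thesis using IH ij by (auto intro: mono_onD)
    qed (use ij const below in auto)
  qed
  moreover have "y j + offset w e \<le> pos s (last (ls @ [h])) + cur_w s (last (ls @ [h]))"
    if "j \<in> {1..<e}" for j
    using edge const[of j] below[of j] that by (cases "j < h") auto
  moreover have "clump_cost w f 1 e (\<lambda>j. min b (max a (y j))) \<le> clump_cost w f 1 e z"
    if z: "mono_on {1..<e} z" "z ` {1..<e} \<subseteq> {a..b}" for z
  proof -
    have m: "mono_on {1..<h} z" "mono_on {h..<e} z"
      using h by (auto intro!: mono_onI mono_onD[OF z(1)])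
    have r: "z ` {1..<h} \<subseteq> {a..b}" "z ` {h..<e} \<subseteq> {a..b}"
      using h z(2) by (auto simp: image_subset_iff)
    have r': "z ` {h..<e} \<subseteq> {xmin..ymax}"
      using r(2) ab by auto
    have "poolable w f {xmin..ymax} h e"
      using snoc.hyps(2) by (simp add: is_block_def)
    then obtain t where t: "t \<in> {z h..z (e - 1)}" "block_cost h e t \<le> clump_cost w f h e z"
      using m(2) r' unfolding poolable_def by meson
    have "z h \<in> {a..b}" "z (e - 1) \<in> {a..b}"
      using r(2) h by (auto simp: image_subset_iff)
    then have "t \<in> {a..b}" using t by auto
    have "clump_cost w f h e (\<lambda>j. min b (max a (y j))) = block_cost h e (min b (max a v))"
      by (rule clump_cost_cong) (auto simp: const)
    \<comment> \<open>The projection of \<open>v\<close> to \<open>{a..b}\<close> lies between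
      \<open>v\<close> and every point \<open>t\<close> of that interval, and \<open>v\<close>
      minimizes over the larger \<open>{xmin..ymax}\<close>.\<close>
    also have "\<dots> \<le> block_cost h e t"
    proof (rule convex_on_le_towards_minimizer[OF convex_block_cost[OF h(1,3)]])
      show "v \<in> minimizers (block_cost h e) {xmin..ymax}"
        using snoc.hyps(3) by (simp add: v_def)
      show "t \<in> {xmin..ymax}" using \<open>t \<in> {a..b}\<close> ab by auto
      show "min b (max a v) \<in> closed_segment v t"
        using \<open>t \<in> {a..b}\<close> by (auto simp: closed_segment_eq_real_ivl min_def max_def)
    qed
    also note t(2)
    finally show ?thesis
      using IH m(1) r(1) clump_cost_split[of 1 h e w f] h by (force intro: add_mono)
  qed
  ultimately show ?case by blast
qed

end

text \<open>Indices are filled in increasing order, so the value at \<open>j - 1\<close> is already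
  final when \<open>j\<close> is filled. The recursion therefore holds for the final
  function.\<close>

lemma fold_fill_positions:
  fixes w p :: "nat \<Rightarrow> real" and A :: "nat set"
  defines "X \<equiv> \<lambda>m. fold (\<lambda>i x. if i \<in> A then x else x(i := x (i - 1) + w (i - 1))) [1..<m + 1] p"
  shows "X m j = (if j \<in> {1..m} \<and> j \<notin> A then X m (j - 1) + w (j - 1) else p j)"
proof (induction m arbitrary: j)
  case 0
  then show ?case by (simp add: X_def)
next
  case (Suc m)
  have "X (Suc m) = (if Suc m \<in> A then X m else (X m)(Suc m := X m m + w m))"
    by (simp add: X_def)
  then show ?case
    using Suc[of j] by (auto simp: le_Suc_eq)
qed

section \<open>Transfer back to the original coordinates\<close>

theorem theorem2p4:
  fixes n :: nat and w :: "nat \<Rightarrow> real" and f :: "nat \<Rightarrow> real \<Rightarrow> real"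
    and xmin xmax xmin' xmax' :: real
  assumes "srp_instance n w xmin' xmax' f"
    and "xmin \<le> xmin'" and "xmin' < xmax'" and "xmax' \<le> xmax"
  shows "srp_optimal n w xmin' xmax' f
           (\<lambda>i. min (xmax' - (\<Sum>j=i..n. w j))
                    (max (xmin' + (\<Sum>j=1..<i. w j))
                         (clumping n w xmin xmax f i)))"
proof -
  interpret single_row n w xmin xmax f
    using assms by unfold_locales (auto simp: srp_instance_def)
  define s where "s = fold (place n w xmin xmax) [1..<n + 1] (init_state n w xmin f)"
  define x where "x = clumping n w xmin xmax f"
  define y where "y j = x j - offset w j" for j
  \<comment> \<open>The counterpart of \<open>ymax\<close> for the smaller interval.\<close>
  define b where "b = xmax' - (\<Sum>j=1..n. w j)"
  define y' where "y' j = min b (max xmin' (y j))" for j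
  let ?x' = "\<lambda>i. min (xmax' - (\<Sum>j=i..n. w j)) (max (xmin' + (\<Sum>j=1..<i. w j)) (x i))"
  have ab: "xmin \<le> xmin'" "xmin' \<le> b" "b \<le> ymax"
    using assms by (auto simp: srp_instance_def b_def ymax_def)
  have "\<exists>ls. placed s ls (n + 1) \<and> clist s = ls"
    using fold_place_placed[of n] unfolding s_def by auto
  then have pl: "placed s (clist s) (n + 1)" by blast
  have "x j = (if j \<in> set (clist s) then pos s j else x (j - 1) + w (j - 1))"
    if "j \<in> {1..<n + 1}" for j
    using fold_fill_positions[of "set (clist s)" w n "pos s" j] that
    unfolding x_def clumping_def s_def[symmetric] Let_def by auto
  note P = placed_positions[OF pl this ab, folded y_def, folded y'_def]
  have total: "(\<Sum>j=1..n. w j) = offset w i + (\<Sum>j=i..n. w j)" if "i \<in> {1..n}" for i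
    using sum.atLeastLessThan_concat[of 1 i "Suc n" w] that
    by (simp add: offset_def atLeastLessThanSuc_atLeastAtMost)
  \<comment> \<open>Removing the offset turns the bounds that depend on \<open>i\<close> into the
    fixed interval \<open>{xmin'..b}\<close>.\<close>
  have x': "?x' i = y' i + offset w i" if "i \<in> {1..n}" for i
    using total[OF that] by (auto simp: y'_def y_def b_def offset_def min_def max_def)
  have y'_mono: "y' i \<le> y' j" if "1 \<le> i" "i \<le> j" "j \<le> n" for i j
  proof -
    have "y i \<le> y j" using P that by (auto intro: mono_onD)
    then show ?thesis by (auto simp: y'_def min_def max_def)
  qed
  have y'_range: "y' i \<in> {xmin'..b}" for i
    using ab by (auto simp: y'_def)
  have feas: "srp_feasible n w xmin' xmax' ?x'"
    unfolding srp_feasible_def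
  proof (intro conjI impI ballI)
    assume "1 \<le> n"
    then show "xmin' \<le> ?x' 1"
      using y'_range[of 1] x'[of 1] by (simp add: offset_def)
    show "?x' n + w n \<le> xmax'"
      by simp
  next
    fix i assume "i \<in> {1..<n}"
    then show "?x' i + w i \<le> ?x' (i + 1)"
      using x'[of i] x'[of "i + 1"] y'_mono[of i "i + 1"] offset_Suc[of i w] by simp
  qed
  have cost: "(\<Sum>i=1..n. f i (u i)) = clump_cost w f 1 (n + 1) (\<lambda>j. u j - offset w j)" for u
    by (simp add: clump_cost_def atLeastLessThanSuc_atLeastAtMost)
  have "(\<Sum>i=1..n. f i (?x' i)) \<le> (\<Sum>i=1..n. f i (u i))"
    if u: "srp_feasible n w xmin' xmax' u" for u
  proof -
    \<comment> \<open>Feasibility of \<open>u\<close> makes \<open>z\<close> monotone with values in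
      \<open>{xmin'..b}\<close>, a competitor covered by \<open>placed_positions\<close>.\<close>
    define z where "z j = u j - offset w j" for j
    have z_Suc: "z i \<le> z (Suc i)" if "i \<in> {1..<n}" for i
      using u that offset_Suc[of i w] by (force simp: srp_feasible_def z_def)
    have mono: "i \<le> j \<Longrightarrow> 1 \<le> i \<Longrightarrow> j \<le> n \<Longrightarrow> z i \<le> z j" for i j
    proof (induction j rule: dec_induct)
      case (step j)
      then show ?case using z_Suc[of j] by force
    qed simp
    have "z j \<in> {xmin'..b}" if "j \<in> {1..n}" for j
    proof -
      have "xmin' \<le> z 1" "z n \<le> b"
        using u that total[of n] by (auto simp: srp_feasible_def z_def b_def offset_def)
      then show ?thesis using mono[of 1 j] mono[of j n] that by auto
    qed
    then have "z ` {1..<n + 1} \<subseteq> {xmin'..b}" by auto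
    moreover have "mono_on {1..<n + 1} z"
      using mono by (auto intro: mono_onI)
    ultimately have "clump_cost w f 1 (n + 1) y' \<le> clump_cost w f 1 (n + 1) z"
      using P by blast
    moreover have "clump_cost w f 1 (n + 1) (\<lambda>j. ?x' j - offset w j) = clump_cost w f 1 (n + 1) y'"
      by (rule clump_cost_cong) (use x' in auto)
    ultimately show ?thesis
      unfolding cost z_def by simp
  qed
  with feas show ?thesis
    unfolding srp_optimal_def is_arg_min_def x_def by (auto simp: not_less)
qed

end
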